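(* Assume that for all $\alpha>0$, problem $(P_\alpha)$ possesses an optimal solution which belongs to $Z_1^*$. Then the following two statements are valid: (i) There exists a scalar $\bar\alpha>0$ such that for all $\alpha\geq\bar\alpha$, any global optimal solution $(\bar x_\alpha,\bar y_\alpha,\bar z_\alpha)$ of problem $(P_\alpha)$ which belongs to $Z_1^*$ is a global optimal solution of problem (KKT). (ii) There exists a scalar $\bar\alpha>0$ such that for all $\alpha\geq\bar\alpha$, any global optimal solution $(\bar x,\bar y,\bar z)$ of problem (KKT) is a global optimal solution of problem $(P_\alpha)$.
   Context: Let $D\in\mathbb{R}^{m\times n}$, $d\in\mathbb{R}^m$, $A\in\mathbb{R}^{l\times n}$, $b\in\mathbb{R}^l$, and let $F:\mathbb{R}^n\times\mathbb{R}^n\to\mathbb{R}$ be twice continuously differentiable. All vector inequalities are componentwise. Problem (KKT) (the Karush-Kuhn-Tucker reformulation of the bilevel program $\min_{x,y} F(x,y)$ s.t. $Dx\le d$, $y\in\operatorname{Argmin}_y\{x^\top y\mid Ay\le b\}$) is $$\min_{x,y,z} F(x,y)\quad\text{s.t. } Dx\le d,\ A^\top z+x=0,\ Ay\le b,\ z\ge 0,\ z^\top(Ay-b)=0,$$ with $x,y\in\mathbb{R}^n$, $z\in\mathbb{R}^l$. For $i=1,\dots,l$ let $T_i:=\{(a,b')\in\mathbb{R}^2\mid a\ge 0,\ b'\ge 0,\ a+b'=1\}$. Define $$\pi(y,z):=\sum_{i=1}^l \min_{(r_i,s_i)\in T_i}\bigl(r_i z_i+s_i(b-Ay)_i\bigr).$$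 Let $Z_1:=\{(x,y,z)\mid Dx\le d,\ Ay\le b,\ A^\top z+x=0,\ z\ge 0\}$ and let $Z_1^*$ be the set of vertices (extreme points) of the polyhedron $Z_1$. For $\alpha>0$, problem $(P_\alpha)$ is $$\min_{x,y,z} F(x,y)+\alpha\,\pi(y,z)\quad\text{s.t. } (x,y,z)\in Z_1.$$ *)

theory Defs
  imports "HOL-Analysis.Analysis"
begin

definition twice_continuously_differentiable :: "('a::real_normed_vector \<Rightarrow> real) \<Rightarrow> bool" where
  "twice_continuously_differentiable f \<longleftrightarrow>
     (\<exists>(f' :: 'a \<Rightarrow> 'a \<Rightarrow>\<^sub>L real) (f'' :: 'a \<Rightarrow> 'a \<Rightarrow>\<^sub>L 'a \<Rightarrow>\<^sub>L real).
        (\<forall>p. (f has_derivative blinfun_apply (f' p)) (at p)) \<and>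
        (\<forall>p. (f' has_derivative blinfun_apply (f'' p)) (at p)) \<and>
        continuous_on UNIV f'')"

text \<open>The order on \<open>real ^ 'k\<close> is the componentwise one.\<close>

definition feasible_KKT ::
  "real^'n^'m \<Rightarrow> real^'m \<Rightarrow> real^'n^'l \<Rightarrow> real^'l \<Rightarrow> ((real^'n) \<times> (real^'n) \<times> (real^'l)) set" where
  "feasible_KKT D d A b =
     {(x, y, z). D *v x \<le> d \<and> transpose A *v z + x = 0 \<and> A *v y \<le> b \<and> 0 \<le> z \<and>
                 z \<bullet> (A *v y - b) = 0}"

definition optimal_KKT ::
  "real^'n^'m \<Rightarrow> real^'m \<Rightarrow> real^'n^'l \<Rightarrow> real^'l \<Rightarrow> ((real^'n) \<times> (real^'n) \<Rightarrow> real)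
     \<Rightarrow> (real^'n) \<times> (real^'n) \<times> (real^'l) \<Rightarrow> bool" where
  "optimal_KKT D d A b F = is_arg_min (\<lambda>(x, y, z). F (x, y)) (\<lambda>p. p \<in> feasible_KKT D d A b)"

text \<open>The sets \<open>T\<^sub>i\<close> are the same for all indices \<open>i\<close>.\<close>

definition T :: "(real \<times> real) set" where
  "T = {(r, s). 0 \<le> r \<and> 0 \<le> s \<and> r + s = 1}"

definition penalty :: "real^'n^'l \<Rightarrow> real^'l \<Rightarrow> real^'n \<Rightarrow> real^'l \<Rightarrow> real" where
  "penalty A b y z = (\<Sum>i\<in>UNIV. INF (r, s)\<in>T. r * z $ i + s * (b - A *v y) $ i)"

text \<open>The infimum in \<open>penalty\<close> is attained, i.e. it is a minimum.\<close>

lemma penalty_inf_attained: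
  fixes u v :: real
  shows "\<exists>(r, s)\<in>T. (INF (r, s)\<in>T. r * u + s * v) = r * u + s * v"
proof -
  let ?g = "\<lambda>p. fst p * u + snd p * v"
  have T_image: "T = (\<lambda>t. (t, 1 - t)) ` {0..1}"
  proof
    show "T \<subseteq> (\<lambda>t. (t, 1 - t)) ` {0..1}"
    proof
      fix p assume "p \<in> T"
      then have "fst p \<in> {0..1}" "p = (fst p, 1 - fst p)"
        unfolding T_def by (simp_all add: case_prod_beta prod_eq_iff)
      then show "p \<in> (\<lambda>t. (t, 1 - t)) ` {0..1}" by (rule rev_image_eqI)
    qed
    show "(\<lambda>t. (t, 1 - t)) ` {0..1} \<subseteq> T"
      unfolding T_def by (rule image_subsetI) simp
  qed
  have compact: "compact T"
    unfolding T_image by (intro compact_continuous_image continuous_intros compact_Icc)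
  have nonempty: "T \<noteq> {}"
    unfolding T_image by simp
  have "continuous_on T ?g"
    by (intro continuous_intros)
  then obtain p where p: "p \<in> T" "\<And>q. q \<in> T \<Longrightarrow> ?g p \<le> ?g q"
    using continuous_attains_inf[OF compact nonempty] by blast
  have "Inf (?g ` T) = ?g p"
    by (rule cInf_eq_minimum) (use p in \<open>blast+\<close>)
  then have "case p of (r, s) \<Rightarrow> (INF (r, s)\<in>T. r * u + s * v) = r * u + s * v"
    unfolding case_prod_beta by simp
  with p(1) show ?thesis
    by (rule bexI[rotated])
qed

definition Z1 ::
  "real^'n^'m \<Rightarrow> real^'m \<Rightarrow> real^'n^'l \<Rightarrow> real^'l \<Rightarrow> ((real^'n) \<times> (real^'n) \<times> (real^'l)) set" where
  "Z1 D d A b = {(x, y, z). D *v x \<le> d \<and> A *v y \<le> b \<and> transpose A *v z + x = 0 \<and> 0 \<le> z}"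

definition vertices_Z1 ::
  "real^'n^'m \<Rightarrow> real^'m \<Rightarrow> real^'n^'l \<Rightarrow> real^'l \<Rightarrow> ((real^'n) \<times> (real^'n) \<times> (real^'l)) set" where
  "vertices_Z1 D d A b = {p. p extreme_point_of Z1 D d A b}"

definition optimal_P ::
  "real^'n^'m \<Rightarrow> real^'m \<Rightarrow> real^'n^'l \<Rightarrow> real^'l \<Rightarrow> ((real^'n) \<times> (real^'n) \<Rightarrow> real)
     \<Rightarrow> real \<Rightarrow> (real^'n) \<times> (real^'n) \<times> (real^'l) \<Rightarrow> bool" where
  "optimal_P D d A b F \<alpha> =
     is_arg_min (\<lambda>(x, y, z). F (x, y) + \<alpha> * penalty A b y z) (\<lambda>p. p \<in> Z1 D d A b)"

end

theory Submission
  imports Defs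
begin

text \<open>
  On \<open>Z1\<close> the multipliers \<open>z\<close> and the slacks \<open>b - A y\<close> are nonnegative, and the penalty is
  \<open>\<Sum>\<^sub>i min z\<^sub>i (b - A y)\<^sub>i\<close>. It is therefore nonnegative there and vanishes exactly where
  complementarity holds: the feasible set of (KKT) is the zero set of the penalty in \<open>Z1\<close>
  (\<open>feasible_KKT_eq_zero_penalty\<close>).

  The polyhedron \<open>Z1\<close> has only finitely many vertices. Fix one point \<open>q\<close> that is feasible for
  (KKT). A vertex \<open>v\<close> with positive penalty has a larger penalised objective than \<open>q\<close> as soon
  as \<open>\<alpha>\<close> is large, so by finiteness there is one threshold beyond which no such vertex solves
  \<open>P\<^sub>\<alpha>\<close> (\<open>exact_penalty_threshold\<close>). Above the threshold every optimal vertex is feasible for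
  (KKT). Since \<open>P\<^sub>\<alpha>\<close> is a relaxation of (KKT) with the same objective on the feasible points of
  (KKT), such a vertex is optimal for (KKT). Because an optimal vertex exists, both problems
  have the same optimal value, and this makes the optimal points of (KKT) optimal for \<open>P\<^sub>\<alpha>\<close>.
  The same threshold serves both statements.

  What remains is that \<open>q\<close> exists whenever \<open>Z1\<close> is nonempty. For \<open>(x, y, z) \<in> Z1\<close>, the point
  \<open>y\<close> is feasible for the linear program that minimises \<open>x \<bullet> y\<close> subject to \<open>A y \<le> b\<close>, and \<open>z\<close>
  is feasible for its dual. Strong duality provides optimal \<open>y'\<close> and \<open>z'\<close> for the same \<open>x\<close>, and
  a zero duality gap is complementarity. Strong duality is deduced from Farkas' lemma,
  which in turn is separation from a closed, finitely generated cone.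
\<close>

section \<open>Farkas' lemma and linear programming duality\<close>

text \<open>
  A finitely generated cone is closed, so a point outside it is strictly separated from it by
  a hyperplane. Scaling the cone elements moves the hyperplane through the origin.
\<close>

lemma farkas:
  fixes S :: "'a::euclidean_space set"
  assumes "finite S" "p \<notin> convex_cone hull S"
  obtains a where "\<And>s. s \<in> S \<Longrightarrow> 0 \<le> a \<bullet> s" "a \<bullet> p < 0"
proof -
  let ?K = "convex_cone hull S"
  obtain a c where ac: "a \<bullet> p < c" "\<And>k. k \<in> ?K \<Longrightarrow> c < a \<bullet> k"
    using separating_hyperplane_closed_point[OF convex_convex_cone_hull
        closed_convex_cone_hull[OF assms(1)] assms(2)] by blast
  have c: "c < 0"
    using ac(2)[OF convex_cone_hull_contains_0] by simp
  have "0 \<le> a \<bullet> s" if "s \<in> S" for s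
  proof (rule ccontr)
    assume neg: "\<not> 0 \<le> a \<bullet> s"
    \<comment> \<open>The multiple of \<open>s\<close> that lies exactly on the separating hyperplane.\<close>
    have "(c / (a \<bullet> s)) *\<^sub>R s \<in> ?K"
      using that neg c by (intro convex_cone_hull_mul hull_inc) (auto simp: divide_nonpos_neg)
    from ac(2)[OF this] neg show False by simp
  qed
  moreover have "a \<bullet> p < 0" using ac(1) c by simp
  ultimately show thesis by (rule that)
qed

lemma inner_matrix_vector_transpose:
  fixes A :: "real^'n^'l"
  shows "z \<bullet> (A *v y) = (transpose A *v z) \<bullet> y"
  by (simp add: dot_lmul_matrix)

lemma nonneg_Basis_vec:
  fixes e :: "real^'k"
  assumes "e \<in> Basis"
  shows "0 \<le> e"
  unfolding eucl_le[of 0 e] using assms by (auto simp: inner_Basis)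

text \<open>
  For feasible \<open>y\<close> and \<open>z\<close> the quantity \<open>b \<bullet> z + x \<bullet> y\<close> is the duality gap.
\<close>

lemma weak_duality:
  fixes A :: "real^'n^'l"
  assumes "A *v y \<le> b" "0 \<le> z" "transpose A *v z + x = 0"
  shows "b \<bullet> z + x \<bullet> y = z \<bullet> (b - A *v y)" "0 \<le> b \<bullet> z + x \<bullet> y"
proof -
  have x: "x = - (transpose A *v z)"
    using assms(3) by (simp add: eq_neg_iff_add_eq_0 add.commute)
  show eq: "b \<bullet> z + x \<bullet> y = z \<bullet> (b - A *v y)"
    unfolding x inner_diff_right inner_matrix_vector_transpose by (simp add: inner_commute)
  show "0 \<le> b \<bullet> z + x \<bullet> y"
    unfolding eq using assms(1,2) by (intro inner_nonneg_nonneg) simp_all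
qed

text \<open>
  Primal feasibility with slack \<open>s\<close>, dual feasibility and a nonpositive duality gap with slack
  \<open>\<sigma>\<close> form a single linear system, and the right-hand sides for which it is
  solvable form a finitely generated cone.
  If the system has no solution, then Farkas' lemma yields a triple \<open>(u, w, t)\<close>. For
  \<open>t > 0\<close> the scaled pair \<open>(- w / t, u / t)\<close> is primal and dual feasible and violates weak
  duality. For \<open>t = 0\<close> the vectors \<open>- w\<close> and \<open>u\<close> are recession directions of the primal and the
  dual polyhedron that improve the two objectives in total, which the given feasible points
  exclude.
\<close>

lemma strong_duality:
  fixes A :: "real^'n^'l"
  assumes y0: "A *v y\<^sub>0 \<le> b" and z0: "0 \<le> z\<^sub>0" "transpose A *v z\<^sub>0 + x = 0"
  obtains y z where "A *v y \<le> b" "0 \<le> z" "transpose A *v z + x = 0" "b \<bullet> z + x \<bullet> y \<le> 0"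
proof -
  define f where "f = (\<lambda>(y, z, s, \<sigma>). (A *v y + s, transpose A *v z, b \<bullet> z + x \<bullet> y + \<sigma>))"
  define P :: "((real^'n) \<times> (real^'l) \<times> (real^'l) \<times> real) set"
    where "P = UNIV \<times> {0..} \<times> {0..} \<times> {0..}"
  \<comment> \<open>Generators of \<open>P\<close>. The signed basis accounts for \<open>y\<close> being free, which turns
     the Farkas inequality for this block into an equation.\<close>
  define G :: "((real^'n) \<times> (real^'l) \<times> (real^'l) \<times> real) set"
    where "G = (\<lambda>e. (e, 0, 0, 0)) ` (Basis \<union> uminus ` Basis) \<union> (\<lambda>e. (0, e, 0, 0)) ` Basis
               \<union> (\<lambda>e. (0, 0, e, 0)) ` Basis \<union> {(0, 0, 0, 1)}"
  have lin: "linear f"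
    by (rule linearI)
      (auto simp: f_def matrix_vector_right_distrib matrix_vector_mult_scaleR inner_simps
        algebra_simps simp del: transpose_matrix_vector)
  have "convex_cone P"
    unfolding convex_cone_iff P_def by (auto simp: zero_prod_def scaleR_nonneg_nonneg)
  then have "convex_cone (f ` P)"
    using lin convex_cone_linear_image by blast
  moreover have "f ` G \<subseteq> f ` P"
    by (rule image_mono) (auto simp: G_def P_def nonneg_Basis_vec)
  ultimately have sub: "convex_cone hull (f ` G) \<subseteq> f ` P"
    by (metis hull_minimal)
  have "(b, - x, 0) \<in> convex_cone hull (f ` G)"
  proof (rule ccontr)
    assume "(b, - x, 0) \<notin> convex_cone hull (f ` G)"
    moreover have "finite (f ` G)"
      by (simp add: G_def)
    ultimately obtain a where a: "\<And>g. g \<in> G \<Longrightarrow> 0 \<le> a \<bullet> f g" "a \<bullet> (b, - x, 0) < 0"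
      using farkas by (metis imageI)
    obtain u w t where a_eq: "a = (u, w, t)"
      by (cases a) auto
    have dual_dir: "transpose A *v u + t *\<^sub>R x = 0"
    proof (rule euclidean_eqI)
      fix e :: "real^'n" assume e: "e \<in> Basis"
      have "0 \<le> a \<bullet> f (e, 0, 0, 0)" "0 \<le> a \<bullet> f (- e, 0, 0, 0)"
        using e by (auto intro!: a(1) simp: G_def)
      then show "(transpose A *v u + t *\<^sub>R x) \<bullet> e = 0 \<bullet> e"
        by (simp add: a_eq f_def inner_matrix_vector_transpose inner_simps)
    qed
    have u: "0 \<le> u"
    proof (subst eucl_le, intro ballI)
      fix e :: "real^'l" assume e: "e \<in> Basis"
      have "0 \<le> a \<bullet> f (0, 0, e, 0)"
        using e by (intro a(1)) (auto simp: G_def)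
      then show "0 \<bullet> e \<le> u \<bullet> e"
        by (simp add: a_eq f_def)
    qed
    have primal_dir: "0 \<le> A *v w + t *\<^sub>R b"
    proof (subst eucl_le, intro ballI)
      fix e :: "real^'l" assume e: "e \<in> Basis"
      have "0 \<le> a \<bullet> f (0, e, 0, 0)"
        using e by (intro a(1)) (auto simp: G_def)
      moreover have "w \<bullet> (transpose A *v e) = (A *v w) \<bullet> e"
        by (metis inner_matrix_vector_transpose inner_commute)
      ultimately show "0 \<bullet> e \<le> (A *v w + t *\<^sub>R b) \<bullet> e"
        by (simp add: a_eq f_def inner_simps)
    qed
    have t: "0 \<le> t"
      using a(1)[of "(0, 0, 0, 1)"] by (simp add: G_def a_eq f_def)
    have gap: "b \<bullet> u < x \<bullet> w"
      using a(2) by (simp add: a_eq inner_commute)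
    show False
    proof (cases "t = 0")
      case True
      have "0 \<le> u \<bullet> (b - A *v y\<^sub>0)"
        using u y0 by (intro inner_nonneg_nonneg) simp_all
      also have "\<dots> = b \<bullet> u"
        using dual_dir True
        by (simp add: inner_diff_right inner_matrix_vector_transpose inner_commute)
      finally have "0 \<le> b \<bullet> u" .
      moreover have "0 \<le> z\<^sub>0 \<bullet> (A *v w)"
        using primal_dir True z0(1) by (intro inner_nonneg_nonneg) simp_all
      moreover have "z\<^sub>0 \<bullet> (A *v w) = - (x \<bullet> w)"
        unfolding inner_matrix_vector_transpose
        using z0(2) by (metis add_eq_0_iff2 inner_minus_left)
      ultimately show False
        using gap by simp
    next
      case False
      with t have t: "0 < t" by simp
      have "0 \<le> (1 / t) *\<^sub>R (A *v w + t *\<^sub>R b)"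
        using primal_dir t by (intro scaleR_nonneg_nonneg) simp_all
      then have "A *v ((- 1 / t) *\<^sub>R w) \<le> b"
        using t by (simp add: scaleR_right_distrib vec.scale matrix_vector_mult_scaleR
            vec.neg add.commute flip: diff_le_eq)
      moreover have "0 \<le> (1 / t) *\<^sub>R u"
        using u t by (intro scaleR_nonneg_nonneg) simp_all
      moreover have "transpose A *v ((1 / t) *\<^sub>R u) + x = (1 / t) *\<^sub>R (transpose A *v u + t *\<^sub>R x)"
        using t by (simp add: scaleR_right_distrib matrix_vector_mult_scaleR)
      ultimately have "0 \<le> b \<bullet> ((1 / t) *\<^sub>R u) + x \<bullet> ((- 1 / t) *\<^sub>R w)"
        using dual_dir by (intro weak_duality(2)[of A]) simp_all
      also have "\<dots> = (b \<bullet> u - x \<bullet> w) / t"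
        by (simp add: diff_divide_distrib)
      finally show False
        using gap t by (simp add: zero_le_divide_iff)
    qed
  qed
  with sub obtain y z s \<sigma> where
    eq: "(b, - x, 0) = f (y, z, s, \<sigma>)" and nonneg: "0 \<le> z" "0 \<le> s" "0 \<le> \<sigma>"
    unfolding P_def by (blast dest: subsetD)
  show thesis
  proof (rule that)
    show "A *v y \<le> b" using eq nonneg by (simp add: f_def)
    show "0 \<le> z" by fact
    have "- x = transpose A *v z" using eq by (simp add: f_def)
    then show "transpose A *v z + x = 0" by (metis add.left_inverse)
    have "b \<bullet> z + x \<bullet> y + \<sigma> = 0" using eq unfolding f_def prod.case prod.inject by metis
    with nonneg(3) show "b \<bullet> z + x \<bullet> y \<le> 0" by linarith
  qed
qed

section \<open>Penalty, feasible set and vertices\<close>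

lemma INF_T_eq_min: "(INF (r, s)\<in>T. r * u + s * v) = min u v"
proof (rule cInf_eq_minimum)
  show "min u v \<in> (\<lambda>(r, s). r * u + s * v) ` T"
  proof (cases "u \<le> v")
    case True
    then show ?thesis by (intro image_eqI[of _ _ "(1, 0)"]) (simp_all add: T_def)
  next
    case False
    then show ?thesis by (intro image_eqI[of _ _ "(0, 1)"]) (simp_all add: T_def)
  qed
next
  fix c assume "c \<in> (\<lambda>(r, s). r * u + s * v) ` T"
  then obtain r s where rs: "0 \<le> r" "0 \<le> s" "r + s = 1" and c: "c = r * u + s * v"
    by (auto simp: T_def)
  have "min u v = r * min u v + s * min u v"
    using rs(3) by (simp flip: distrib_right)
  also have "\<dots> \<le> c"
    unfolding c using rs by (intro add_mono mult_left_mono) simp_all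
  finally show "min u v \<le> c" .
qed

lemma penalty_eq_sum_min: "penalty A b y z = (\<Sum>i\<in>UNIV. min (z $ i) ((b - A *v y) $ i))"
  by (simp only: penalty_def INF_T_eq_min)

lemma penalty_nonneg:
  assumes "A *v y \<le> b" "0 \<le> z"
  shows "0 \<le> penalty A b y z"
  using assms unfolding penalty_eq_sum_min by (intro sum_nonneg) (simp add: less_eq_vec_def)

text \<open>
  Up to sign the inner product is, like the penalty, a sum of nonnegative terms, and both \<open>min u v\<close> and \<open>u * v\<close> vanish for
  nonnegative \<open>u\<close> and \<open>v\<close> precisely when one of the two arguments does.
\<close>

lemma penalty_eq_0_iff:
  assumes "A *v y \<le> b" "0 \<le> z"
  shows "penalty A b y z = 0 \<longleftrightarrow> z \<bullet> (A *v y - b) = 0"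
proof -
  have nonneg: "0 \<le> z $ i" "0 \<le> (b - A *v y) $ i" for i
    using assms by (simp_all add: less_eq_vec_def)
  have "penalty A b y z = 0 \<longleftrightarrow> (\<forall>i. min (z $ i) ((b - A *v y) $ i) = 0)"
    unfolding penalty_eq_sum_min using nonneg by (subst sum_nonneg_eq_0_iff) simp_all
  also have "\<dots> \<longleftrightarrow> (\<forall>i. z $ i * (b - A *v y) $ i = 0)"
    using nonneg by (intro all_cong1) (metis min_def mult_eq_0_iff order_antisym)
  also have "\<dots> \<longleftrightarrow> z \<bullet> (b - A *v y) = 0"
    unfolding inner_vec_def using nonneg by (subst sum_nonneg_eq_0_iff) simp_all
  also have "\<dots> \<longleftrightarrow> z \<bullet> (A *v y - b) = 0"
    by (auto simp: inner_diff_right)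
  finally show ?thesis .
qed

lemma feasible_KKT_eq_zero_penalty:
  "feasible_KKT D d A b = {p \<in> Z1 D d A b. (\<lambda>(x, y, z). penalty A b y z) p = 0}"
  by (auto simp: feasible_KKT_def Z1_def penalty_eq_0_iff)

lemma feasible_KKT_nonempty:
  assumes "p \<in> Z1 D d A b"
  shows "feasible_KKT D d A b \<noteq> {}"
proof -
  obtain x y\<^sub>0 z\<^sub>0 where Z: "D *v x \<le> d" "A *v y\<^sub>0 \<le> b" "transpose A *v z\<^sub>0 + x = 0" "0 \<le> z\<^sub>0"
    using assms by (auto simp: Z1_def)
  obtain y z where yz: "A *v y \<le> b" "0 \<le> z" "transpose A *v z + x = 0" "b \<bullet> z + x \<bullet> y \<le> 0"
    using strong_duality[OF Z(2,4,3)] .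
  then have "z \<bullet> (b - A *v y) = 0"
    using weak_duality[OF yz(1-3)] by linarith
  then have "(x, y, z) \<in> feasible_KKT D d A b"
    using Z(1) yz by (simp add: feasible_KKT_def inner_diff_right)
  then show ?thesis by blast
qed

lemma polyhedron_linear_le:
  fixes f :: "'a::euclidean_space \<Rightarrow> 'b::ordered_euclidean_space"
  assumes "linear f"
  shows "polyhedron {p. f p \<le> c}"
proof -
  have "{p. f p \<le> c} = (\<Inter>e\<in>Basis. {p. adjoint f e \<bullet> p \<le> c \<bullet> e})"
    using adjoint_works[OF assms] by (auto simp: eucl_le[of _ c] inner_commute)
  also have "polyhedron \<dots>"
    by (intro polyhedron_Inter) (auto intro: polyhedron_halfspace_le)
  finally show ?thesis .
qed

lemma polyhedron_Z1: "polyhedron (Z1 D d A b)"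
proof -
  have "Z1 D d A b =
      {p. D *v fst p \<le> d} \<inter> {p. A *v fst (snd p) \<le> b} \<inter>
      {p. transpose A *v snd (snd p) + fst p \<le> 0} \<inter>
      {p. - (transpose A *v snd (snd p) + fst p) \<le> 0} \<inter> {p. - snd (snd p) \<le> 0}"
    unfolding Z1_def neg_le_0_iff_le by (auto intro: order_antisym)
  also have "polyhedron \<dots>"
    by (intro polyhedron_Int polyhedron_linear_le linearI)
      (simp_all add: matrix_vector_right_distrib matrix_vector_mult_scaleR scaleR_right_distrib
        scaleR_right_diff_distrib del: transpose_matrix_vector)
  finally show ?thesis .
qed

lemma finite_vertices_Z1: "finite (vertices_Z1 D d A b)"
  unfolding vertices_Z1_def by (intro finite_polyhedron_extreme_points polyhedron_Z1)

section \<open>Exactness of the penalty\<close>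

text \<open>
  A candidate with positive penalty loses against the unpenalised point \<open>q\<close> once \<open>\<alpha>\<close> is large.
  Finitely many candidates have a common threshold.
\<close>

lemma exact_penalty_threshold:
  fixes f \<pi> :: "'a \<Rightarrow> real"
  assumes "finite V" and nonneg: "\<And>p. p \<in> Z \<Longrightarrow> 0 \<le> \<pi> p" and q: "q \<in> Z" "\<pi> q = 0"
  obtains \<alpha>\<^sub>0 where "0 < \<alpha>\<^sub>0"
    "\<And>\<alpha> v. \<lbrakk>\<alpha>\<^sub>0 \<le> \<alpha>; v \<in> V; is_arg_min (\<lambda>p. f p + \<alpha> * \<pi> p) (\<lambda>p. p \<in> Z) v\<rbrakk> \<Longrightarrow> \<pi> v = 0"
proof -
  have "eventually (\<lambda>\<alpha>. 0 < \<pi> v \<longrightarrow> f q < f v + \<alpha> * \<pi> v) at_top" for v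
    using eventually_gt_at_top[of "(f q - f v) / \<pi> v"]
    by eventually_elim (auto simp: field_simps)
  then have "eventually (\<lambda>\<alpha>. \<forall>v\<in>V. 0 < \<pi> v \<longrightarrow> f q < f v + \<alpha> * \<pi> v) at_top"
    using \<open>finite V\<close> by (intro eventually_ball_finite) auto
  then obtain N where N: "\<And>\<alpha> v. \<lbrakk>N \<le> \<alpha>; v \<in> V; 0 < \<pi> v\<rbrakk> \<Longrightarrow> f q < f v + \<alpha> * \<pi> v"
    unfolding eventually_at_top_linorder by blast
  show thesis
  proof (rule that[of "max N 1"])
    fix \<alpha> v
    assume *: "max N 1 \<le> \<alpha>" "v \<in> V" "is_arg_min (\<lambda>p. f p + \<alpha> * \<pi> p) (\<lambda>p. p \<in> Z) v"
    then have "v \<in> Z" "f v + \<alpha> * \<pi> v \<le> f q"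
      using q by (auto simp: is_arg_min_linorder)
    then show "\<pi> v = 0"
      using N[of \<alpha> v] nonneg[of v] * by force
  qed simp
qed

theorem proposition3p1:
  fixes D :: "real^'n^'m" and d :: "real^'m"
    and A :: "real^'n^'l" and b :: "real^'l"
    and F :: "(real^'n) \<times> (real^'n) \<Rightarrow> real"
  assumes "twice_continuously_differentiable F"
    and "\<forall>\<alpha>>0. \<exists>p \<in> vertices_Z1 D d A b. optimal_P D d A b F \<alpha> p"
  shows "(\<exists>\<alpha>\<^sub>0>0. \<forall>\<alpha>\<ge>\<alpha>\<^sub>0. \<forall>x y z.
            optimal_P D d A b F \<alpha> (x, y, z) \<and> (x, y, z) \<in> vertices_Z1 D d A b \<longrightarrow>
            optimal_KKT D d A b F (x, y, z)) \<and>
         (\<exists>\<alpha>\<^sub>0>0. \<forall>\<alpha>\<ge>\<alpha>\<^sub>0. \<forall>x y z.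
            optimal_KKT D d A b F (x, y, z) \<longrightarrow> optimal_P D d A b F \<alpha> (x, y, z))"
proof -
  let ?V = "vertices_Z1 D d A b" and ?Z = "Z1 D d A b" and ?K = "feasible_KKT D d A b"
  define f where "f = (\<lambda>(x, y, z :: real^'l). F (x, y))"
  define \<pi> where "\<pi> = (\<lambda>(x :: real^'n, y, z). penalty A b y z)"
  have K: "?K = {p \<in> ?Z. \<pi> p = 0}"
    unfolding \<pi>_def by (rule feasible_KKT_eq_zero_penalty)
  have optP: "optimal_P D d A b F \<alpha> p \<longleftrightarrow> is_arg_min (\<lambda>p. f p + \<alpha> * \<pi> p) (\<lambda>p. p \<in> ?Z) p" for \<alpha> p
    unfolding optimal_P_def f_def \<pi>_def by (simp only: case_prod_unfold)
  have optK: "optimal_KKT D d A b F p \<longleftrightarrow> is_arg_min f (\<lambda>p. p \<in> ?K) p" for p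
    by (simp add: optimal_KKT_def f_def)
  have \<pi>_nonneg: "0 \<le> \<pi> p" if "p \<in> ?Z" for p
    using that by (auto simp: \<pi>_def Z1_def penalty_nonneg)
  obtain p where "optimal_P D d A b F 1 p"
    using assms(2) zero_less_one by blast
  then have "p \<in> ?Z"
    by (simp add: optP is_arg_min_def)
  then obtain q where q: "q \<in> ?K"
    using feasible_KKT_nonempty by blast
  obtain \<alpha>\<^sub>0 where \<alpha>0: "0 < \<alpha>\<^sub>0"
    and thr: "\<And>\<alpha> v. \<lbrakk>\<alpha>\<^sub>0 \<le> \<alpha>; v \<in> ?V; is_arg_min (\<lambda>p. f p + \<alpha> * \<pi> p) (\<lambda>p. p \<in> ?Z) v\<rbrakk> \<Longrightarrow> \<pi> v = 0"
    using exact_penalty_threshold[of ?V ?Z \<pi> q f] finite_vertices_Z1 \<pi>_nonneg q K by blast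
  have vertex: "\<pi> v = 0" "optimal_KKT D d A b F v"
    if \<alpha>: "\<alpha>\<^sub>0 \<le> \<alpha>" and v: "v \<in> ?V" "optimal_P D d A b F \<alpha> v" for \<alpha> v
  proof -
    have v_min: "v \<in> ?Z" "\<And>p. p \<in> ?Z \<Longrightarrow> f v + \<alpha> * \<pi> v \<le> f p + \<alpha> * \<pi> p"
      using v(2) unfolding optP is_arg_min_linorder by blast+
    show \<pi>v: "\<pi> v = 0"
      using thr[OF \<alpha> v(1)] v(2) unfolding optP by blast
    have "f v \<le> f p" if "p \<in> ?K" for p
      using v_min(2)[of p] that \<pi>v by (simp add: K)
    then show "optimal_KKT D d A b F v"
      unfolding optK is_arg_min_linorder using v_min(1) \<pi>v K by blast
  qed
  have kkt: "optimal_P D d A b F \<alpha> p"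
    if \<alpha>: "\<alpha>\<^sub>0 \<le> \<alpha>" and p: "optimal_KKT D d A b F p" for \<alpha> p
  proof -
    have "0 < \<alpha>"
      using \<alpha>0 \<alpha> by linarith
    then obtain v where v: "v \<in> ?V" "optimal_P D d A b F \<alpha> v"
      using assms(2) by blast
    note \<pi>v = vertex(1)[OF \<alpha> v] and v_opt = vertex(2)[OF \<alpha> v]
    have "f p \<le> f v" "p \<in> ?Z" "\<pi> p = 0"
      using p v_opt unfolding optK is_arg_min_linorder K by blast+
    moreover have "f v + \<alpha> * \<pi> v \<le> f q + \<alpha> * \<pi> q" if "q \<in> ?Z" for q
      using v(2) that unfolding optP is_arg_min_linorder by blast
    ultimately show ?thesis
      unfolding optP is_arg_min_linorder using \<pi>v by fastforce
  qed
  from \<alpha>0 vertex kkt show ?thesis by blast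
qed

end
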